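(* Let $G=\langle\rho,\tau\rangle$ be a group with $\tau^2=1$, let $U$ be a core-free subgroup of $G$, and suppose the monodromy graph $\Gamma=\mathrm{Mon}(G;U,\rho,\tau)$ is connected. For $a\in N_G(U)$ let $a_L$ be the map on the vertex set $V$ of $\Gamma$ given by $(Uh\langle\rho\rangle)^{a_L}=a^{-1}Uh\langle\rho\rangle=Ua^{-1}h\langle\rho\rangle$, and let $A=\{a_L\mid a\in N_G(U)\}$. Then: (i) $A$ is a subgroup of $\mathrm{Aut}(\Gamma)$; (ii) if $U=1$, then $\Gamma$ is arc-transitive.
   Context: A subgroup $U\le G$ is core-free if $\bigcap_{g\in G}g^{-1}Ug=1$; $N_G(U)$ is the normalizer. Monodromy graph: for $G=\langle\rho,\tau\rangle$ with $\tau^2=1$, $U$ core-free, $H=\langle\rho\rangle$, and $S$ a right transversal of $U$ in $G$, $\mathrm{Mon}(G;U,\rho,\tau)$ has vertex set $\{UgH\mid g\in G\}$, edge set $\{\{UhH,Uh\tau H\}\mid h\in S\}$, and for $h\in S$ the multiplicity of the edge between $UhH$ and $Uh\tau H$ is $|D|$ where $D=\{g\in S\mid g\in UhH \text{ and } g\tau\in Uh\tau H\}$; the edge is a free edge if $h\tau\in Uh$ and a loop if $h\tau\notin Uh$ but $h\tau\in UhH$. An automorphism of $\Gamma$ is a permutation of the vertices mapping edges to edges and preserving edge multiplicities. A graph is arc-transitive if its automorphism group acts transitively on its arcs (ordered pairs of adjacent vertices). *)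

theory Defs
  imports "HOL-Algebra.Group_Action" "HOL-Algebra.Generated_Groups" "HOL-Library.Extended_Nat"
begin

(* An edge is the set of its ends, so an edge with one end is a singleton;
   loops and free (dangling) edges at v are both {v}. *)
record 'v multigraph =
  mg_verts :: "'v set"
  mg_edges :: "'v set set"
  mg_mult  :: "'v set \<Rightarrow> enat"

definition mg_arcs :: "('v, 'm) multigraph_scheme \<Rightarrow> ('v \<times> 'v) set" where
  "mg_arcs \<Gamma> = {(v, w). v \<in> mg_verts \<Gamma> \<and> w \<in> mg_verts \<Gamma> \<and> {v, w} \<in> mg_edges \<Gamma>}"

definition mg_connected :: "('v, 'm) multigraph_scheme \<Rightarrow> bool" where
  "mg_connected \<Gamma> \<longleftrightarrow> mg_verts \<Gamma> \<noteq> {} \<and>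
     (\<forall>v\<in>mg_verts \<Gamma>. \<forall>w\<in>mg_verts \<Gamma>. (v, w) \<in> (mg_arcs \<Gamma>)\<^sup>*)"

(* The edge set is required to be mapped onto itself: for finite graphs this follows
   from mapping edges to edges, for infinite graphs it is needed for inverses. *)
definition mg_Aut :: "('v, 'm) multigraph_scheme \<Rightarrow> ('v \<Rightarrow> 'v) set" where
  "mg_Aut \<Gamma> = {\<phi> \<in> Bij (mg_verts \<Gamma>).
     (\<lambda>e. \<phi> ` e) ` mg_edges \<Gamma> = mg_edges \<Gamma> \<and>
     (\<forall>e\<in>mg_edges \<Gamma>. mg_mult \<Gamma> (\<phi> ` e) = mg_mult \<Gamma> e)}"

definition mg_Aut_group :: "('v, 'm) multigraph_scheme \<Rightarrow> ('v \<Rightarrow> 'v) monoid" where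
  "mg_Aut_group \<Gamma> = BijGroup (mg_verts \<Gamma>) \<lparr>carrier := mg_Aut \<Gamma>\<rparr>"

definition mg_arc_transitive :: "('v, 'm) multigraph_scheme \<Rightarrow> bool" where
  "mg_arc_transitive \<Gamma> \<longleftrightarrow>
     (\<forall>(v, w)\<in>mg_arcs \<Gamma>. \<forall>(v', w')\<in>mg_arcs \<Gamma>. \<exists>\<phi>\<in>mg_Aut \<Gamma>. \<phi> v = v' \<and> \<phi> w = w')"

lemma mg_Aut_subgroup:
  assumes E: "mg_edges \<Gamma> \<subseteq> Pow (mg_verts \<Gamma>)"
  shows "subgroup (mg_Aut \<Gamma>) (BijGroup (mg_verts \<Gamma>))"
proof -
  let ?V = "mg_verts \<Gamma>" let ?E = "mg_edges \<Gamma>"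
  interpret B: group "BijGroup ?V" by (rule group_BijGroup)
  have cB: "carrier (BijGroup ?V) = Bij ?V" by (simp add: BijGroup_def)
  have idA: "(\<lambda>x\<in>?V. x) \<in> mg_Aut \<Gamma>"
  proof -
    have "(\<lambda>x\<in>?V. x) ` e = e" if "e \<in> ?E" for e using that E by force
    then show ?thesis by (simp add: mg_Aut_def id_Bij)
  qed
  show ?thesis
  proof (rule B.subgroupI)
    show "mg_Aut \<Gamma> \<subseteq> carrier (BijGroup ?V)" by (auto simp: cB mg_Aut_def)
    show "mg_Aut \<Gamma> \<noteq> {}" using idA by blast
  next
    fix f assume f: "f \<in> mg_Aut \<Gamma>"
    let ?g = "\<lambda>x\<in>?V. inv_into ?V f x"
    have fB: "f \<in> Bij ?V" and fE: "(\<lambda>e. f ` e) ` ?E = ?E"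
      and fm: "\<forall>e\<in>?E. mg_mult \<Gamma> (f ` e) = mg_mult \<Gamma> e"
      using f by (auto simp: mg_Aut_def)
    have bij: "bij_betw f ?V ?V" using fB by (simp add: Bij_def)
    have gf: "?g ` (f ` e) = e" if "e \<in> ?E" for e
    proof -
      have eV: "e \<subseteq> ?V" using \<open>e \<in> ?E\<close> E by blast
      have gfx: "?g (f x) = x" if "x \<in> e" for x
      proof -
        have x: "x \<in> ?V" using that eV by blast
        then have "f x \<in> ?V" using bij by (auto simp: bij_betw_def)
        then show ?thesis using x bij by (simp add: bij_betw_def)
      qed
      have "?g ` (f ` e) = (\<lambda>x. ?g (f x)) ` e" by (rule image_image)
      also have "\<dots> = e" using gfx by simp
      finally show ?thesis .
    qed
    have "(\<lambda>e. ?g ` e) ` ?E = (\<lambda>e. ?g ` e) ` ((\<lambda>e. f ` e) ` ?E)" by (simp only: fE)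
    also have "\<dots> = (\<lambda>e. ?g ` (f ` e)) ` ?E" by (rule image_image)
    also have "\<dots> = ?E" using gf by simp
    finally have gE: "(\<lambda>e. ?g ` e) ` ?E = ?E" .
    have gm: "mg_mult \<Gamma> (?g ` e) = mg_mult \<Gamma> e" if e: "e \<in> ?E" for e
    proof -
      obtain e' where e': "e' \<in> ?E" "e = f ` e'" using e fE by blast
      then show ?thesis using gf[OF e'(1)] fm by simp
    qed
    have "?g \<in> mg_Aut \<Gamma>"
      unfolding mg_Aut_def using gE gm restrict_inv_into_Bij[OF fB] by blast
    then show "inv\<^bsub>BijGroup ?V\<^esub> f \<in> mg_Aut \<Gamma>" using inv_BijGroup[OF fB] by simp
  next
    fix f g assume f: "f \<in> mg_Aut \<Gamma>" and g: "g \<in> mg_Aut \<Gamma>"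
    have fB: "f \<in> Bij ?V" and gB: "g \<in> Bij ?V" using f g by (auto simp: mg_Aut_def)
    have im: "compose ?V f g ` e = f ` (g ` e)" if "e \<in> ?E" for e
      using that E by (force simp: compose_def)
    have fE: "(\<lambda>e. f ` e) ` ?E = ?E" and gE: "(\<lambda>e. g ` e) ` ?E = ?E"
      using f g by (auto simp: mg_Aut_def)
    have "(\<lambda>e. compose ?V f g ` e) ` ?E = (\<lambda>e. f ` (g ` e)) ` ?E" using im by (rule image_cong[OF refl])
    also have "\<dots> = (\<lambda>e. f ` e) ` ((\<lambda>e. g ` e) ` ?E)" by (rule image_image[symmetric])
    also have "\<dots> = ?E" by (simp only: gE fE)
    finally have "(\<lambda>e. compose ?V f g ` e) ` ?E = ?E" .
    moreover have "mg_mult \<Gamma> (compose ?V f g ` e) = mg_mult \<Gamma> e" if e: "e \<in> ?E" for e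
    proof -
      have "g ` e \<in> ?E" using e gE by blast
      then show ?thesis using e f g im[OF e] by (simp add: mg_Aut_def)
    qed
    ultimately have "compose ?V f g \<in> mg_Aut \<Gamma>"
      using compose_Bij[OF fB gB] by (simp add: mg_Aut_def)
    then show "f \<otimes>\<^bsub>BijGroup ?V\<^esub> g \<in> mg_Aut \<Gamma>" using fB gB by (simp add: BijGroup_def)
  qed
qed

lemma group_mg_Aut_group:
  assumes "mg_edges \<Gamma> \<subseteq> Pow (mg_verts \<Gamma>)"
  shows "group (mg_Aut_group \<Gamma>)"
  unfolding mg_Aut_group_def
  by (rule subgroup.subgroup_is_group[OF mg_Aut_subgroup[OF assms] group_BijGroup])

definition core_free :: "('a, 'b) monoid_scheme \<Rightarrow> 'a set \<Rightarrow> bool" where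
  "core_free G U \<longleftrightarrow>
     (\<Inter>g\<in>carrier G. (inv\<^bsub>G\<^esub> g <#\<^bsub>G\<^esub> U) #>\<^bsub>G\<^esub> g) = {\<one>\<^bsub>G\<^esub>}"

definition right_transversal :: "('a, 'b) monoid_scheme \<Rightarrow> 'a set \<Rightarrow> 'a set \<Rightarrow> bool" where
  "right_transversal G U S \<longleftrightarrow>
     S \<subseteq> carrier G \<and> (\<forall>C\<in>rcosets\<^bsub>G\<^esub> U. \<exists>!s. s \<in> S \<and> s \<in> C)"

definition double_coset :: "('a, 'b) monoid_scheme \<Rightarrow> 'a set \<Rightarrow> 'a \<Rightarrow> 'a set \<Rightarrow> 'a set" where
  "double_coset G U g H = (U #>\<^bsub>G\<^esub> g) <#>\<^bsub>G\<^esub> H"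

definition mon_vertex :: "('a, 'b) monoid_scheme \<Rightarrow> 'a set \<Rightarrow> 'a \<Rightarrow> 'a \<Rightarrow> 'a set" where
  "mon_vertex G U \<rho> g = double_coset G U g (generate G {\<rho>})"

definition mon_edge :: "('a, 'b) monoid_scheme \<Rightarrow> 'a set \<Rightarrow> 'a \<Rightarrow> 'a \<Rightarrow> 'a \<Rightarrow> 'a set set" where
  "mon_edge G U \<rho> \<tau> h = {mon_vertex G U \<rho> h, mon_vertex G U \<rho> (h \<otimes>\<^bsub>G\<^esub> \<tau>)}"

definition mon_D :: "('a, 'b) monoid_scheme \<Rightarrow> 'a set \<Rightarrow> 'a set \<Rightarrow> 'a \<Rightarrow> 'a \<Rightarrow> 'a \<Rightarrow> 'a set" where
  "mon_D G U S \<rho> \<tau> h =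
     {g \<in> S. g \<in> mon_vertex G U \<rho> h \<and> g \<otimes>\<^bsub>G\<^esub> \<tau> \<in> mon_vertex G U \<rho> (h \<otimes>\<^bsub>G\<^esub> \<tau>)}"

(* Infinite multiplicities are all identified; nothing is lost, as sets of elements of
   a finitely generated group are countable. *)
definition esize :: "'a set \<Rightarrow> enat" where
  "esize A = (if finite A then enat (card A) else \<infinity>)"

definition Mon :: "('a, 'b) monoid_scheme \<Rightarrow> 'a set \<Rightarrow> 'a set \<Rightarrow> 'a \<Rightarrow> 'a \<Rightarrow> 'a set multigraph" where
  "Mon G U S \<rho> \<tau> =
     \<lparr>mg_verts = {mon_vertex G U \<rho> g | g. g \<in> carrier G},
      mg_edges = {mon_edge G U \<rho> \<tau> h | h. h \<in> S},
      mg_mult = (\<lambda>e. THE m. \<exists>h\<in>S. e = mon_edge G U \<rho> \<tau> h \<and> m = esize (mon_D G U S \<rho> \<tau> h))\<rparr>"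

(* The action a_L is written on the right in the usual notation, so a_L followed by b_L
   is (ab)_L; as elements of BijGroup, whose product is composition of functions, the
   factors appear in reverse order, which does not affect being a subgroup. *)
definition mon_left :: "('a, 'b) monoid_scheme \<Rightarrow> 'a set \<Rightarrow> 'a \<Rightarrow> 'a \<Rightarrow> 'a set \<Rightarrow> 'a set" where
  "mon_left G U \<rho> a =
     (\<lambda>v\<in>{mon_vertex G U \<rho> g | g. g \<in> carrier G}. inv\<^bsub>G\<^esub> a <#\<^bsub>G\<^esub> v)"

definition mon_left_group :: "('a, 'b) monoid_scheme \<Rightarrow> 'a set \<Rightarrow> 'a \<Rightarrow> ('a set \<Rightarrow> 'a set) set" where
  "mon_left_group G U \<rho> = {mon_left G U \<rho> a | a. a \<in> normalizer G U}"


context group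
begin

lemma mon_vertex_iff:
  "x \<in> mon_vertex G U \<rho> g \<longleftrightarrow> (\<exists>u\<in>U. \<exists>h\<in>generate G {\<rho>}. x = u \<otimes> g \<otimes> h)"
  by (auto simp: mon_vertex_def double_coset_def set_mult_def r_coset_def)

lemma mon_vertex_left_closed:
  assumes U: "subgroup U G" and \<rho>: "\<rho> \<in> carrier G" and g: "g \<in> carrier G"
    and u: "u \<in> U" and x: "x \<in> mon_vertex G U \<rho> g"
  shows "u \<otimes> x \<in> mon_vertex G U \<rho> g"
proof -
  obtain u' h where *: "u' \<in> U" "h \<in> generate G {\<rho>}" "x = u' \<otimes> g \<otimes> h"
    using x unfolding mon_vertex_iff by blast
  have "h \<in> carrier G" using *(2) generate_in_carrier[of "{\<rho>}"] \<rho> by auto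
  then have "u \<otimes> x = (u \<otimes> u') \<otimes> g \<otimes> h"
    using * g u subgroup.mem_carrier[OF U] by (simp add: m_assoc)
  then show ?thesis
    unfolding mon_vertex_iff using *(1,2) subgroup.m_closed[OF U u] by blast
qed

lemma esize_flip:
  fixes V W :: "'a set"
  assumes U: "subgroup U G" and S: "right_transversal G U S"
    and \<tau>: "\<tau> \<in> carrier G" and \<tau>2: "\<tau> [^] (2::nat) = \<one>"
    and V: "\<And>u x. u \<in> U \<Longrightarrow> x \<in> V \<Longrightarrow> u \<otimes> x \<in> V"
    and W: "\<And>u x. u \<in> U \<Longrightarrow> x \<in> W \<Longrightarrow> u \<otimes> x \<in> W"
  shows "esize {g \<in> S. g \<in> V \<and> g \<otimes> \<tau> \<in> W} = esize {g \<in> S. g \<in> W \<and> g \<otimes> \<tau> \<in> V}"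
proof -
  let ?A = "{g \<in> S. g \<in> V \<and> g \<otimes> \<tau> \<in> W}" and ?B = "{g \<in> S. g \<in> W \<and> g \<otimes> \<tau> \<in> V}"
  define r where "r = (\<lambda>x. THE s. s \<in> S \<and> s \<in> U #> x)"
  have SG: "S \<subseteq> carrier G" using S by (simp add: right_transversal_def)
  have ex1: "\<exists>!s. s \<in> S \<and> s \<in> U #> x" if "x \<in> carrier G" for x
    using S that by (auto simp: right_transversal_def RCOSETS_def)
  have r: "r x \<in> S" "r x \<in> U #> x" if "x \<in> carrier G" for x
    using theI'[OF ex1[OF that]] by (auto simp: r_def)
  have r_eq: "r x = s" if "x \<in> carrier G" "s \<in> S" "s \<in> U #> x" for x s
    using ex1[OF that(1)] r[OF that(1)] that by blast
  have tt: "\<tau> \<otimes> \<tau> = \<one>" using \<tau>2 \<tau> by (simp add: numeral_2_eq_2)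
  have key: "r (g \<otimes> \<tau>) \<in> S \<and> (\<exists>u\<in>U. r (g \<otimes> \<tau>) = u \<otimes> (g \<otimes> \<tau>) \<and> r (g \<otimes> \<tau>) \<otimes> \<tau> = u \<otimes> g)
             \<and> r (r (g \<otimes> \<tau>) \<otimes> \<tau>) = g" if g: "g \<in> S" for g
  proof -
    have gc: "g \<in> carrier G" using g SG by auto
    obtain u where u: "u \<in> U" "r (g \<otimes> \<tau>) = u \<otimes> (g \<otimes> \<tau>)"
      using r(2)[of "g \<otimes> \<tau>"] gc \<tau> by (auto simp: r_coset_def)
    have uc: "u \<in> carrier G" using u U subgroup.mem_carrier by fast
    have *: "r (g \<otimes> \<tau>) \<otimes> \<tau> = u \<otimes> g" using u gc \<tau> uc tt by (simp add: m_assoc)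
    have "g = inv u \<otimes> (u \<otimes> g)" using uc gc by (simp add: m_assoc[symmetric])
    then have "g \<in> U #> (u \<otimes> g)"
      using subgroup.m_inv_closed[OF U u(1)] by (auto simp: r_coset_def)
    then have "r (u \<otimes> g) = g" using r_eq g uc gc by simp
    then show ?thesis using * u r(1)[of "g \<otimes> \<tau>"] gc \<tau> by auto
  qed
  have "bij_betw (\<lambda>g. r (g \<otimes> \<tau>)) ?A ?B"
  proof (rule bij_betw_byWitness[where f' = "\<lambda>g. r (g \<otimes> \<tau>)"])
    show "\<forall>g\<in>?A. r (r (g \<otimes> \<tau>) \<otimes> \<tau>) = g" "\<forall>g\<in>?B. r (r (g \<otimes> \<tau>) \<otimes> \<tau>) = g" using key by auto
    show "(\<lambda>g. r (g \<otimes> \<tau>)) ` ?A \<subseteq> ?B"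
    proof (rule image_subsetI)
      fix g assume g: "g \<in> ?A"
      then obtain u where "u \<in> U" "r (g \<otimes> \<tau>) = u \<otimes> (g \<otimes> \<tau>)" "r (g \<otimes> \<tau>) \<otimes> \<tau> = u \<otimes> g"
        using key[of g] by blast
      moreover have "u \<otimes> (g \<otimes> \<tau>) \<in> W" "u \<otimes> g \<in> V"
        using g V[OF \<open>u \<in> U\<close>, of g] W[OF \<open>u \<in> U\<close>, of "g \<otimes> \<tau>"] by simp_all
      ultimately show "r (g \<otimes> \<tau>) \<in> ?B" using key[of g] g by simp
    qed
    show "(\<lambda>g. r (g \<otimes> \<tau>)) ` ?B \<subseteq> ?A"
    proof (rule image_subsetI)
      fix g assume g: "g \<in> ?B"
      then obtain u where "u \<in> U" "r (g \<otimes> \<tau>) = u \<otimes> (g \<otimes> \<tau>)" "r (g \<otimes> \<tau>) \<otimes> \<tau> = u \<otimes> g"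
        using key[of g] by blast
      moreover have "u \<otimes> (g \<otimes> \<tau>) \<in> V" "u \<otimes> g \<in> W"
        using g W[OF \<open>u \<in> U\<close>, of g] V[OF \<open>u \<in> U\<close>, of "g \<otimes> \<tau>"] by simp_all
      ultimately show "r (g \<otimes> \<tau>) \<in> ?A" using key[of g] g by simp
    qed
  qed
  then show ?thesis
    using bij_betw_finite bij_betw_same_card by (auto simp: esize_def)
qed

(* The multiplicity of an edge does not depend on the element of S representing it,
   so the definite description in Mon denotes. *)
lemma mg_mult_Mon:
  assumes "subgroup U G" and "right_transversal G U S"
    and "\<rho> \<in> carrier G" and "\<tau> \<in> carrier G" and "\<tau> [^] (2::nat) = \<one>" and h: "h \<in> S"
  shows "mg_mult (Mon G U S \<rho> \<tau>) (mon_edge G U \<rho> \<tau> h) = esize (mon_D G U S \<rho> \<tau> h)"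
proof -
  have SG: "S \<subseteq> carrier G" using assms(2) by (simp add: right_transversal_def)
  have "esize (mon_D G U S \<rho> \<tau> k) = esize (mon_D G U S \<rho> \<tau> h)"
    if k: "k \<in> S" and e: "mon_edge G U \<rho> \<tau> h = mon_edge G U \<rho> \<tau> k" for k
  proof -
    let ?v = "\<lambda>g. mon_vertex G U \<rho> g"
    have hk: "h \<in> carrier G" "k \<in> carrier G" using h k SG by auto
    have "esize {g \<in> S. g \<in> ?v h \<and> g \<otimes> \<tau> \<in> ?v (h \<otimes> \<tau>)}
        = esize {g \<in> S. g \<in> ?v (h \<otimes> \<tau>) \<and> g \<otimes> \<tau> \<in> ?v h}"
      by (rule esize_flip[OF assms(1,2,4,5)])
         (rule mon_vertex_left_closed[OF assms(1,3)]; use assms(4) hk in simp)+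
    then show ?thesis
      using e unfolding mon_edge_def mon_D_def doubleton_eq_iff by (elim disjE conjE) simp_all
  qed
  then have "(THE m. \<exists>k\<in>S. mon_edge G U \<rho> \<tau> h = mon_edge G U \<rho> \<tau> k \<and> m = esize (mon_D G U S \<rho> \<tau> k))
      = esize (mon_D G U S \<rho> \<tau> h)"
    by (intro the_equality) (use h in blast)+
  then show ?thesis by (simp add: Mon_def)
qed

lemma mg_edges_Mon_subset:
  assumes "right_transversal G U S" and "\<tau> \<in> carrier G"
  shows "mg_edges (Mon G U S \<rho> \<tau>) \<subseteq> Pow (mg_verts (Mon G U S \<rho> \<tau>))"
proof -
  have "S \<subseteq> carrier G" using assms by (simp add: right_transversal_def)
  then have "mon_edge G U \<rho> \<tau> h \<subseteq> mg_verts (Mon G U S \<rho> \<tau>)" if "h \<in> S" for h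
    using that assms(2) m_closed[of h \<tau>] unfolding Mon_def mon_edge_def by fastforce
  then show ?thesis by (auto simp: Mon_def)
qed

lemma mem_normalizer_iff:
  assumes "U \<subseteq> carrier G"
  shows "a \<in> normalizer G U \<longleftrightarrow> a \<in> carrier G \<and> a <# U #> inv a = U"
  using assms by (simp add: normalizer_def stabilizer_def)

lemma mon_left_mon_vertex:
  assumes U: "subgroup U G" and \<rho>: "\<rho> \<in> carrier G"
    and a: "a \<in> normalizer G U" and h: "h \<in> carrier G"
  shows "mon_left G U \<rho> a (mon_vertex G U \<rho> h) = mon_vertex G U \<rho> (inv a \<otimes> h)"
proof -
  let ?H = "generate G {\<rho>}"
  have UG: "U \<subseteq> carrier G" and HG: "?H \<subseteq> carrier G"
    using U \<rho> generate_incl[of "{\<rho>}"] by (auto simp: subgroup.subset)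
  have ac: "a \<in> carrier G" and aU: "a <# U #> inv a = U"
    using a mem_normalizer_iff[OF UG] by auto
  have "inv a <# U = U #> inv a"
  proof -
    have "inv a <# U = inv a <# (a <# U #> inv a)" using aU by simp
    also have "\<dots> = (inv a <# (a <# U)) #> inv a"
      using ac UG by (simp add: coset_assoc l_coset_subset_G)
    also have "inv a <# (a <# U) = U" using ac UG by (simp add: lcos_m_assoc lcos_mult_one)
    finally show ?thesis .
  qed
  then have *: "(inv a <# U) #> h = U #> (inv a \<otimes> h)"
    using ac UG h by (simp add: coset_mult_assoc)
  have "inv a <# ((U #> h) <#> ?H) = (inv a <# (U #> h)) <#> ?H"
    unfolding l_coset_eq_set_mult
    using ac UG HG h by (intro set_mult_assoc[symmetric]) (auto simp: r_coset_subset_G)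
  also have "inv a <# (U #> h) = U #> (inv a \<otimes> h)"
    using * ac UG h by (simp add: coset_assoc)
  finally have "inv a <# ((U #> h) <#> ?H) = (U #> (inv a \<otimes> h)) <#> ?H" .
  then show ?thesis using h by (auto simp: mon_left_def mon_vertex_def double_coset_def)
qed

end

end

(* An element a of N_G(U) permutes the right cosets of U by left multiplication with a^{-1}.
   This action commutes with right multiplication by rho and tau, hence permutes the double
   cosets UhH and the pairs {UhH, Uh tau H}, and, transported to the transversal S, maps the
   set D of an edge bijectively onto the set D of its image. For U = 1 the normalizer is all
   of G, which is transitive on the arcs (hH, h tau H). *)
theory Submission
  imports Defs
begin

section \<open>A criterion for automorphisms of a multigraph\<close>

text \<open>\<open>mg_Aut\<close> asks for the edge set to be mapped onto itself, which does not
  follow from mapping edges to edges when the graph is infinite. A right inverse on the vertices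
  that also maps edges to edges supplies the missing preimage of each edge.\<close>

lemma mg_AutI:
  assumes bij: "\<phi> \<in> Bij (mg_verts \<Gamma>)"
    and E: "mg_edges \<Gamma> \<subseteq> Pow (mg_verts \<Gamma>)"
    and \<phi>: "\<And>e. e \<in> mg_edges \<Gamma> \<Longrightarrow> \<phi> ` e \<in> mg_edges \<Gamma>"
    and \<psi>: "\<And>e. e \<in> mg_edges \<Gamma> \<Longrightarrow> \<psi> ` e \<in> mg_edges \<Gamma>"
    and inv: "\<And>v. v \<in> mg_verts \<Gamma> \<Longrightarrow> \<phi> (\<psi> v) = v"
    and mult: "\<And>e. e \<in> mg_edges \<Gamma> \<Longrightarrow> mg_mult \<Gamma> (\<phi> ` e) = mg_mult \<Gamma> e"
  shows "\<phi> \<in> mg_Aut \<Gamma>"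
proof -
  have "e \<in> (\<lambda>e. \<phi> ` e) ` mg_edges \<Gamma>" if e: "e \<in> mg_edges \<Gamma>" for e
  proof -
    have "\<phi> ` (\<psi> ` e) = (\<lambda>v. \<phi> (\<psi> v)) ` e" by (rule image_image)
    also have "\<dots> = (\<lambda>v. v) ` e" using e E inv by (intro image_cong) auto
    finally have "\<phi> ` (\<psi> ` e) = e" by simp
    then show ?thesis using \<psi>[OF e] by (metis imageI)
  qed
  then show ?thesis
    using bij mult \<phi> unfolding mg_Aut_def by blast
qed

context group
begin

section \<open>Conjugation by the normalizer, left factors from U, and the transversal\<close>

lemma normalizer_conj_closed:
  assumes "subgroup U G" and "a \<in> normalizer G U" and "u \<in> U"
  shows "a \<otimes> u \<otimes> inv a \<in> U"
proof -
  have "a <# U #> inv a = U"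
    using assms mem_normalizer_iff[OF subgroup.subset[OF assms(1)]] by blast
  then show ?thesis using assms(3) by (auto simp: l_coset_def r_coset_def)
qed

text \<open>The coset absorbs the factor: U(ug) = Ug. Since left factors commute with right
  multiplication by \<open>\<tau>\<close>, the edge and the set D of h also depend only on the coset
  Uh, which the next two lemmas record.\<close>

lemma mon_vertex_left_mult:
  assumes U: "subgroup U G" and \<rho>: "\<rho> \<in> carrier G" and g: "g \<in> carrier G" and u: "u \<in> U"
  shows "mon_vertex G U \<rho> (u \<otimes> g) = mon_vertex G U \<rho> g"
proof -
  have "U #> (u \<otimes> g) = (U #> u) #> g"
    using subgroup.subset[OF U] g u by (intro coset_mult_assoc[symmetric]) auto
  also have "U #> u = U"
    using subgroup.subset[OF U] u U by (intro coset_join2) auto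
  finally show ?thesis by (simp add: mon_vertex_def double_coset_def)
qed

lemma mon_edge_left_mult:
  assumes "subgroup U G" and "\<rho> \<in> carrier G" and "\<tau> \<in> carrier G"
    and "h \<in> carrier G" and "u \<in> U"
  shows "mon_edge G U \<rho> \<tau> (u \<otimes> h) = mon_edge G U \<rho> \<tau> h"
proof -
  have "u \<in> carrier G" using assms subgroup.mem_carrier by fast
  then show ?thesis
    using assms mon_vertex_left_mult[OF assms(1,2)] by (simp add: mon_edge_def m_assoc)
qed

lemma mon_D_left_mult:
  assumes "subgroup U G" and "\<rho> \<in> carrier G" and "\<tau> \<in> carrier G"
    and "h \<in> carrier G" and "u \<in> U"
  shows "mon_D G U S \<rho> \<tau> (u \<otimes> h) = mon_D G U S \<rho> \<tau> h"
proof -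
  have "u \<in> carrier G" using assms subgroup.mem_carrier by fast
  then show ?thesis
    using assms mon_vertex_left_mult[OF assms(1,2)] by (simp add: mon_D_def m_assoc)
qed

lemma right_transversal_ex:
  assumes "right_transversal G U S" and "x \<in> carrier G"
  shows "\<exists>u\<in>U. u \<otimes> x \<in> S"
proof -
  have "U #> x \<in> rcosets U" using assms(2) by (auto simp: RCOSETS_def)
  then obtain s where "s \<in> S" "s \<in> U #> x"
    using assms(1) unfolding right_transversal_def by blast
  then show ?thesis by (auto simp: r_coset_def)
qed

text \<open>Uniqueness of representatives, phrased with an explicit factor u because elements of
  \<open>S\<close> arise below as such multiples of a known one.\<close>

lemma right_transversal_unique:
  assumes "subgroup U G" and "right_transversal G U S"
    and "s \<in> S" and "u \<in> U" and "u \<otimes> s \<in> S"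
  shows "u \<otimes> s = s"
proof -
  have s: "s \<in> carrier G" using assms by (auto simp: right_transversal_def)
  then have "U #> s \<in> rcosets U" by (auto simp: RCOSETS_def)
  moreover have "u \<otimes> s \<in> U #> s" using assms(4) by (auto simp: r_coset_def)
  moreover have "s \<in> U #> s" using rcos_self[OF s assms(1)] .
  ultimately show ?thesis using assms unfolding right_transversal_def by blast
qed

section \<open>Edges and multiplicities at arbitrary group elements\<close>

lemma mon_edge_in_mg_edges:
  assumes "subgroup U G" and "right_transversal G U S"
    and "\<rho> \<in> carrier G" and "\<tau> \<in> carrier G" and "x \<in> carrier G"
  shows "mon_edge G U \<rho> \<tau> x \<in> mg_edges (Mon G U S \<rho> \<tau>)"
proof -
  obtain u where "u \<in> U" "u \<otimes> x \<in> S" using right_transversal_ex assms by blast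
  then show ?thesis using mon_edge_left_mult[of U \<rho> \<tau> x u] assms by (auto simp: Mon_def)
qed

lemma mg_edges_Mon:
  assumes "subgroup U G" and "right_transversal G U S"
    and "\<rho> \<in> carrier G" and "\<tau> \<in> carrier G"
  shows "mg_edges (Mon G U S \<rho> \<tau>) = mon_edge G U \<rho> \<tau> ` carrier G"
  using mon_edge_in_mg_edges[OF assms] assms(2)
  by (auto simp: Mon_def right_transversal_def)

text \<open>\<open>Mon\<close> describes its edges by elements of \<open>S\<close>, but left
  multiplication by an element of the normalizer can leave \<open>S\<close>. A left factor from U
  brings x back into \<open>S\<close> and changes neither the edge nor D.\<close>

lemma mg_mult_Mon_carrier:
  assumes "subgroup U G" and "right_transversal G U S"
    and "\<rho> \<in> carrier G" and "\<tau> \<in> carrier G" and "\<tau> [^] (2::nat) = \<one>" and "x \<in> carrier G"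
  shows "mg_mult (Mon G U S \<rho> \<tau>) (mon_edge G U \<rho> \<tau> x) = esize (mon_D G U S \<rho> \<tau> x)"
proof -
  obtain u where "u \<in> U" "u \<otimes> x \<in> S" using right_transversal_ex assms by blast
  then show ?thesis
    using mg_mult_Mon[of U S \<rho> \<tau> "u \<otimes> x"] mon_edge_left_mult[of U \<rho> \<tau> x u]
      mon_D_left_mult[of U \<rho> \<tau> x u] assms by simp
qed

section \<open>The left action of the normalizer on edges, multiplicities and vertices\<close>

lemma mon_left_image_mon_edge:
  assumes "subgroup U G" and "\<rho> \<in> carrier G" and "\<tau> \<in> carrier G"
    and "a \<in> normalizer G U" and "h \<in> carrier G"
  shows "mon_left G U \<rho> a ` mon_edge G U \<rho> \<tau> h = mon_edge G U \<rho> \<tau> (inv a \<otimes> h)"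
proof -
  have "a \<in> carrier G"
    using assms normalizer_imp_subgroup[OF subgroup.subset] subgroup.mem_carrier by fast
  then show ?thesis
    using assms by (simp add: mon_edge_def mon_left_mon_vertex m_assoc)
qed

text \<open>Multiply g in D by a on the left, then return to \<open>S\<close> by a left factor from
  U. This is a bijection between the two sets D; the same construction with \<open>inv a\<close> is
  its inverse.\<close>

lemma esize_mon_D_left_mult:
  assumes U: "subgroup U G" and S: "right_transversal G U S"
    and \<rho>: "\<rho> \<in> carrier G" and \<tau>: "\<tau> \<in> carrier G"
    and a: "a \<in> normalizer G U" and h: "h \<in> carrier G"
  shows "esize (mon_D G U S \<rho> \<tau> (a \<otimes> h)) = esize (mon_D G U S \<rho> \<tau> h)"
proof -
  have SG: "S \<subseteq> carrier G" using S by (simp add: right_transversal_def)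
  have N: "subgroup (normalizer G U) G" using normalizer_imp_subgroup subgroup.subset[OF U] .
  note Nc = subgroup.mem_carrier[OF N] and Uc = subgroup.mem_carrier[OF U]
  have "\<exists>r. \<forall>x\<in>carrier G. r x \<in> S \<and> (\<exists>u\<in>U. r x = u \<otimes> x)"
    using right_transversal_ex[OF S] by (intro bchoice) blast
  \<comment> \<open>\<open>r x\<close> is the representative in \<open>S\<close> of the coset
    Ux.\<close>
  then obtain r where r: "r x \<in> S" "\<exists>u\<in>U. r x = u \<otimes> x" if "x \<in> carrier G" for x by blast
  \<comment> \<open>If u corrects bg and w corrects the way back, the round trip gives w(b^-1 u b)g.
    The conjugate lies in U, so this is an element of \<open>S\<close> in the coset Ug, namely g.
    With b general, the fact serves both \<open>a\<close> and \<open>inv a\<close>.\<close>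
  have inverse: "r (inv b \<otimes> r (b \<otimes> g)) = g" if b: "b \<in> normalizer G U" and g: "g \<in> S" for b g
  proof -
    have c: "b \<in> carrier G" "g \<in> carrier G" using b g Nc SG by auto
    obtain u where u: "u \<in> U" "r (b \<otimes> g) = u \<otimes> (b \<otimes> g)" using r(2)[of "b \<otimes> g"] c by auto
    obtain w where w: "w \<in> U" "r (inv b \<otimes> r (b \<otimes> g)) = w \<otimes> (inv b \<otimes> r (b \<otimes> g))"
      using r(2)[of "inv b \<otimes> r (b \<otimes> g)"] r(1)[of "b \<otimes> g"] c SG by auto
    have uw: "u \<in> carrier G" "w \<in> carrier G" using u w Uc by auto
    have "inv b \<otimes> u \<otimes> b \<in> U"
      using normalizer_conj_closed[OF U subgroup.m_inv_closed[OF N b] u(1)] c by simp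
    then have "w \<otimes> (inv b \<otimes> u \<otimes> b) \<in> U" using w(1) subgroup.m_closed[OF U] by blast
    moreover have "r (inv b \<otimes> r (b \<otimes> g)) = w \<otimes> (inv b \<otimes> u \<otimes> b) \<otimes> g"
      using w u c uw by (simp add: m_assoc)
    moreover have "r (inv b \<otimes> r (b \<otimes> g)) \<in> S" using r(1) c SG by (meson inv_closed m_closed subsetD)
    ultimately show ?thesis using right_transversal_unique[OF U S g] by metis
  qed
  \<comment> \<open>Left multiplication by b takes the vertex of x to that of bx, and this vertex
    absorbs the correcting factor u. Applied to g and to its product with \<open>\<tau>\<close>,
    this carries over both conditions defining D.\<close>
  have maps: "r (b \<otimes> g) \<in> mon_D G U S \<rho> \<tau> (b \<otimes> k)"
    if b: "b \<in> normalizer G U" and k: "k \<in> carrier G" and g: "g \<in> mon_D G U S \<rho> \<tau> k" for b g k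
  proof -
    have c: "b \<in> carrier G" "g \<in> carrier G" using b g Nc SG by (auto simp: mon_D_def)
    obtain u where u: "u \<in> U" "r (b \<otimes> g) = u \<otimes> (b \<otimes> g)" using r(2)[of "b \<otimes> g"] c by auto
    have shift: "u \<otimes> (b \<otimes> y) \<in> mon_vertex G U \<rho> (b \<otimes> x)"
      if x: "x \<in> carrier G" and y: "y \<in> mon_vertex G U \<rho> x" for x y
    proof -
      \<comment> \<open>\<open>mon_left\<close> multiplies by the inverse of its argument and is
        restricted to vertices. At \<open>inv b\<close>, and on a vertex, it is therefore plain left
        multiplication by b.\<close>
      have "mon_vertex G U \<rho> x \<in> {mon_vertex G U \<rho> g | g. g \<in> carrier G}" using x by blast
      then have "b <# mon_vertex G U \<rho> x = mon_vertex G U \<rho> (b \<otimes> x)"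
        using mon_left_mon_vertex[OF U \<rho> subgroup.m_inv_closed[OF N b] x] c(1)
        unfolding mon_left_def by (simp only: restrict_apply' inv_inv)
      then have "b \<otimes> y \<in> mon_vertex G U \<rho> (b \<otimes> x)" using y by (auto simp: l_coset_def)
      then show ?thesis using mon_vertex_left_closed[OF U \<rho> _ u(1)] c x by simp
    qed
    have "r (b \<otimes> g) \<otimes> \<tau> = u \<otimes> (b \<otimes> (g \<otimes> \<tau>))" using u c Uc \<tau> by (simp add: m_assoc)
    then show ?thesis
      using shift[of k g] shift[of "k \<otimes> \<tau>" "g \<otimes> \<tau>"] g k c \<tau> u(2) r(1)[of "b \<otimes> g"]
      by (simp add: mon_D_def m_assoc)
  qed
  have ia: "inv a \<in> normalizer G U" using subgroup.m_inv_closed[OF N a] .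
  have "bij_betw (\<lambda>g. r (a \<otimes> g)) (mon_D G U S \<rho> \<tau> h) (mon_D G U S \<rho> \<tau> (a \<otimes> h))"
  proof (rule bij_betw_byWitness[where f' = "\<lambda>g. r (inv a \<otimes> g)"])
    show "\<forall>g\<in>mon_D G U S \<rho> \<tau> h. r (inv a \<otimes> r (a \<otimes> g)) = g"
      using inverse[OF a] by (auto simp: mon_D_def)
    show "\<forall>g\<in>mon_D G U S \<rho> \<tau> (a \<otimes> h). r (a \<otimes> r (inv a \<otimes> g)) = g"
      using inverse[OF ia] Nc[OF a] by (auto simp: mon_D_def)
    show "(\<lambda>g. r (a \<otimes> g)) ` mon_D G U S \<rho> \<tau> h \<subseteq> mon_D G U S \<rho> \<tau> (a \<otimes> h)"
      using maps[OF a h] by blast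
    show "(\<lambda>g. r (inv a \<otimes> g)) ` mon_D G U S \<rho> \<tau> (a \<otimes> h) \<subseteq> mon_D G U S \<rho> \<tau> h"
      using maps[OF ia, of "a \<otimes> h"] Nc[OF a] h by (auto simp: m_assoc[symmetric])
  qed
  then show ?thesis
    using bij_betw_finite bij_betw_same_card by (fastforce simp: esize_def)
qed

text \<open>Both sides multiply a vertex by a^-1 b^-1 = (ba)^-1, so composing functions reverses the
  order of the factors.\<close>

lemma mon_left_compose:
  assumes U: "subgroup U G" and \<rho>: "\<rho> \<in> carrier G"
    and a: "a \<in> normalizer G U" and b: "b \<in> normalizer G U"
  shows "compose {mon_vertex G U \<rho> g | g. g \<in> carrier G} (mon_left G U \<rho> a) (mon_left G U \<rho> b)
    = mon_left G U \<rho> (b \<otimes> a)" (is "compose ?V _ _ = _")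
proof (rule extensionalityI[of _ ?V])
  have N: "subgroup (normalizer G U) G" using normalizer_imp_subgroup subgroup.subset[OF U] .
  note c = subgroup.mem_carrier[OF N a] subgroup.mem_carrier[OF N b]
  show "mon_left G U \<rho> (b \<otimes> a) \<in> extensional ?V" by (simp add: mon_left_def)
  fix v assume v: "v \<in> ?V"
  then obtain g where "g \<in> carrier G" "v = mon_vertex G U \<rho> g" by blast
  then show "compose ?V (mon_left G U \<rho> a) (mon_left G U \<rho> b) v = mon_left G U \<rho> (b \<otimes> a) v"
    using v c mon_left_mon_vertex[OF U \<rho>] a b subgroup.m_closed[OF N b a]
    by (simp add: compose_eq inv_mult_group m_assoc)
qed simp

lemma mon_left_cancel:
  assumes U: "subgroup U G" and \<rho>: "\<rho> \<in> carrier G" and a: "a \<in> normalizer G U"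
    and v: "v \<in> {mon_vertex G U \<rho> g | g. g \<in> carrier G}"
  shows "mon_left G U \<rho> (inv a) (mon_left G U \<rho> a v) = v"
    and "mon_left G U \<rho> a (mon_left G U \<rho> (inv a) v) = v"
proof -
  have N: "subgroup (normalizer G U) G" using normalizer_imp_subgroup subgroup.subset[OF U] .
  obtain g where "g \<in> carrier G" "v = mon_vertex G U \<rho> g" using v by blast
  then show "mon_left G U \<rho> (inv a) (mon_left G U \<rho> a v) = v"
    "mon_left G U \<rho> a (mon_left G U \<rho> (inv a) v) = v"
    using mon_left_mon_vertex[OF U \<rho>] a subgroup.m_inv_closed[OF N a] subgroup.mem_carrier[OF N a]
    by (simp_all add: m_assoc[symmetric])
qed

section \<open>The left multiplications form a group of automorphisms\<close>

lemma mon_left_in_mg_Aut: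
  assumes U: "subgroup U G" and S: "right_transversal G U S"
    and \<rho>: "\<rho> \<in> carrier G" and \<tau>: "\<tau> \<in> carrier G" and \<tau>2: "\<tau> [^] (2::nat) = \<one>"
    and a: "a \<in> normalizer G U"
  shows "mon_left G U \<rho> a \<in> mg_Aut (Mon G U S \<rho> \<tau>)" (is "_ \<in> mg_Aut ?\<Gamma>")
proof (rule mg_AutI[where \<psi> = "mon_left G U \<rho> (inv a)"])
  have N: "subgroup (normalizer G U) G" using normalizer_imp_subgroup subgroup.subset[OF U] .
  have ia: "inv a \<in> normalizer G U" using subgroup.m_inv_closed[OF N a] .
  have c: "a \<in> carrier G" using subgroup.mem_carrier[OF N a] .
  have V: "mg_verts ?\<Gamma> = {mon_vertex G U \<rho> g | g. g \<in> carrier G}" by (simp add: Mon_def)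
  have maps: "mon_left G U \<rho> b v \<in> mg_verts ?\<Gamma>" if "b \<in> normalizer G U" "v \<in> mg_verts ?\<Gamma>" for b v
    using that mon_left_mon_vertex[OF U \<rho>] subgroup.mem_carrier[OF N] unfolding V by fastforce
  have cancel: "mon_left G U \<rho> (inv a) (mon_left G U \<rho> a v) = v"
    "mon_left G U \<rho> a (mon_left G U \<rho> (inv a) v) = v" if "v \<in> mg_verts ?\<Gamma>" for v
    using mon_left_cancel[OF U \<rho> a that[unfolded V]] .
  have "bij_betw (mon_left G U \<rho> a) (mg_verts ?\<Gamma>) (mg_verts ?\<Gamma>)"
    by (rule bij_betw_byWitness[where f' = "mon_left G U \<rho> (inv a)"])
       (simp_all add: cancel maps[OF a] maps[OF ia] image_subset_iff)
  moreover have "mon_left G U \<rho> a \<in> extensional (mg_verts ?\<Gamma>)"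
    by (simp add: mon_left_def Mon_def)
  ultimately show "mon_left G U \<rho> a \<in> Bij (mg_verts ?\<Gamma>)" by (simp add: Bij_def)
  show "mg_edges ?\<Gamma> \<subseteq> Pow (mg_verts ?\<Gamma>)" using mg_edges_Mon_subset[OF S \<tau>] .
  show "mon_left G U \<rho> a (mon_left G U \<rho> (inv a) v) = v" if "v \<in> mg_verts ?\<Gamma>" for v
    using cancel(2)[OF that] .
  fix e assume "e \<in> mg_edges ?\<Gamma>"
  then obtain h where h: "h \<in> carrier G" "e = mon_edge G U \<rho> \<tau> h"
    unfolding mg_edges_Mon[OF U S \<rho> \<tau>] by blast
  note im = mon_left_image_mon_edge[OF U \<rho> \<tau>]
  show "mon_left G U \<rho> a ` e \<in> mg_edges ?\<Gamma>" "mon_left G U \<rho> (inv a) ` e \<in> mg_edges ?\<Gamma>"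
    using h c im[OF a] im[OF ia] mon_edge_in_mg_edges[OF U S \<rho> \<tau>] by simp_all
  \<comment> \<open>The edge of h goes to the edge of a^-1 h, so the equality of the sizes of D is
    applied to \<open>inv a\<close>.\<close>
  show "mg_mult ?\<Gamma> (mon_left G U \<rho> a ` e) = mg_mult ?\<Gamma> e"
    using h c im[OF a] mg_mult_Mon_carrier[OF U S \<rho> \<tau> \<tau>2]
      esize_mon_D_left_mult[OF U S \<rho> \<tau> ia] by simp
qed

lemma subgroup_mon_left_group:
  assumes U: "subgroup U G" and S: "right_transversal G U S"
    and \<rho>: "\<rho> \<in> carrier G" and \<tau>: "\<tau> \<in> carrier G" and \<tau>2: "\<tau> [^] (2::nat) = \<one>"
  shows "subgroup (mon_left_group G U \<rho>) (mg_Aut_group (Mon G U S \<rho> \<tau>))"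
proof -
  let ?\<Gamma> = "Mon G U S \<rho> \<tau>" and ?L = "mon_left G U \<rho>"
  interpret A: group "mg_Aut_group ?\<Gamma>"
    using group_mg_Aut_group mg_edges_Mon_subset[OF S \<tau>] .
  have N: "subgroup (normalizer G U) G" using normalizer_imp_subgroup subgroup.subset[OF U] .
  have aut: "?L a \<in> mg_Aut ?\<Gamma>" if "a \<in> normalizer G U" for a
    using mon_left_in_mg_Aut[OF U S \<rho> \<tau> \<tau>2 that] .
  have carrier: "carrier (mg_Aut_group ?\<Gamma>) = mg_Aut ?\<Gamma>" by (simp add: mg_Aut_group_def)
  have mult: "?L a \<otimes>\<^bsub>mg_Aut_group ?\<Gamma>\<^esub> ?L b = ?L (b \<otimes> a)"
    if "a \<in> normalizer G U" "b \<in> normalizer G U" for a b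
    using mon_left_compose[OF U \<rho> that] aut[OF that(1)] aut[OF that(2)]
    by (simp add: mg_Aut_group_def BijGroup_def mg_Aut_def Mon_def)
  \<comment> \<open>The product formula makes \<open>?L \<one>\<close> idempotent, and the only
    idempotent of a group is its identity.\<close>
  have one: "?L \<one> = \<one>\<^bsub>mg_Aut_group ?\<Gamma>\<^esub>"
    using A.r_cancel_one'[of "?L \<one>" "?L \<one>"] mult[of \<one> \<one>] aut[of \<one>]
      subgroup.one_closed[OF N] carrier by simp
  show ?thesis
  proof (rule A.subgroupI)
    show "mon_left_group G U \<rho> \<subseteq> carrier (mg_Aut_group ?\<Gamma>)"
      using aut by (auto simp: mon_left_group_def carrier)
    show "mon_left_group G U \<rho> \<noteq> {}"
      using subgroup.one_closed[OF N] by (auto simp: mon_left_group_def)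
  next
    fix f assume "f \<in> mon_left_group G U \<rho>"
    then obtain a where a: "a \<in> normalizer G U" "f = ?L a" by (auto simp: mon_left_group_def)
    have ia: "inv a \<in> normalizer G U" using subgroup.m_inv_closed[OF N a(1)] .
    have "?L (inv a) \<otimes>\<^bsub>mg_Aut_group ?\<Gamma>\<^esub> f = \<one>\<^bsub>mg_Aut_group ?\<Gamma>\<^esub>"
      using mult[OF ia a(1)] a(2) subgroup.mem_carrier[OF N a(1)] one by simp
    then have "inv\<^bsub>mg_Aut_group ?\<Gamma>\<^esub> f = ?L (inv a)"
      using A.inv_equality aut a ia carrier by simp
    then show "inv\<^bsub>mg_Aut_group ?\<Gamma>\<^esub> f \<in> mon_left_group G U \<rho>"
      using ia by (auto simp: mon_left_group_def)
  next
    fix f g assume "f \<in> mon_left_group G U \<rho>" "g \<in> mon_left_group G U \<rho>"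
    then show "f \<otimes>\<^bsub>mg_Aut_group ?\<Gamma>\<^esub> g \<in> mon_left_group G U \<rho>"
      using mult subgroup.m_closed[OF N] by (auto simp: mon_left_group_def)
  qed
qed

section \<open>Arc-transitivity for trivial U\<close>

text \<open>The reversed arc of \<open>(UhH, Uh\<tau>H)\<close> is the arc belonging to \<open>h\<tau>\<close>, because \<open>\<tau>\<close> is an
  involution; so every arc has this form.\<close>
lemma mg_arcs_MonE:
  assumes U: "subgroup U G" and S: "right_transversal G U S"
    and \<rho>: "\<rho> \<in> carrier G" and \<tau>: "\<tau> \<in> carrier G" and \<tau>2: "\<tau> [^] (2::nat) = \<one>"
    and vw: "(v, w) \<in> mg_arcs (Mon G U S \<rho> \<tau>)"
  obtains h where "h \<in> carrier G" "v = mon_vertex G U \<rho> h" "w = mon_vertex G U \<rho> (h \<otimes> \<tau>)"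
proof -
  have tt: "\<tau> \<otimes> \<tau> = \<one>" using \<tau>2 \<tau> by (simp add: numeral_2_eq_2)
  obtain h where h: "h \<in> carrier G" "{v, w} = mon_edge G U \<rho> \<tau> h"
    using vw mg_edges_Mon[OF U S \<rho> \<tau>] by (auto simp: mg_arcs_def)
  then consider "v = mon_vertex G U \<rho> h" "w = mon_vertex G U \<rho> (h \<otimes> \<tau>)"
    | "v = mon_vertex G U \<rho> (h \<otimes> \<tau>)" "w = mon_vertex G U \<rho> h"
    by (auto simp: mon_edge_def doubleton_eq_iff)
  then show ?thesis
  proof cases
    case 1
    then show ?thesis using that h by blast
  next
    case 2
    then show ?thesis using that[of "h \<otimes> \<tau>"] h \<tau> tt by (simp add: m_assoc)
  qed
qed

lemma normalizer_one: "normalizer G {\<one>} = carrier G"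
proof -
  have "a <# {\<one>} #> inv a = {\<one>}" if "a \<in> carrier G" for a
    using that by (simp add: l_coset_def r_coset_def)
  then show ?thesis using mem_normalizer_iff[of "{\<one>}"] by blast
qed

lemma mg_arc_transitive_Mon:
  assumes S: "right_transversal G {\<one>} S"
    and \<rho>: "\<rho> \<in> carrier G" and \<tau>: "\<tau> \<in> carrier G" and \<tau>2: "\<tau> [^] (2::nat) = \<one>"
  shows "mg_arc_transitive (Mon G {\<one>} S \<rho> \<tau>)" (is "mg_arc_transitive ?\<Gamma>")
proof -
  have U: "subgroup {\<one>} G" by (rule triv_subgroup)
  have "\<exists>\<phi>\<in>mg_Aut ?\<Gamma>. \<phi> v = v' \<and> \<phi> w = w'"
    if arcs: "(v, w) \<in> mg_arcs ?\<Gamma>" "(v', w') \<in> mg_arcs ?\<Gamma>" for v w v' w'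
  proof -
    let ?v = "mon_vertex G {\<one>} \<rho>"
    obtain h where h: "h \<in> carrier G" "v = ?v h" "w = ?v (h \<otimes> \<tau>)"
      using mg_arcs_MonE[OF U S \<rho> \<tau> \<tau>2 arcs(1)] .
    obtain k where k: "k \<in> carrier G" "v' = ?v k" "w' = ?v (k \<otimes> \<tau>)"
      using mg_arcs_MonE[OF U S \<rho> \<tau> \<tau>2 arcs(2)] .
    \<comment> \<open>Taking h to k requires left multiplication by k h^-1. As
      \<open>mon_left\<close> inverts its argument, the element to use is h k^-1; the same
      multiplication then takes the second end of the first arc to that of the other.\<close>
    have a: "h \<otimes> inv k \<in> normalizer G {\<one>}" using h k by (simp add: normalizer_one)
    have "inv (h \<otimes> inv k) \<otimes> h = k" "inv (h \<otimes> inv k) \<otimes> (h \<otimes> \<tau>) = k \<otimes> \<tau>"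
      using h k \<tau> by (simp_all add: inv_mult_group m_assoc inv_solve_left')
    then have "mon_left G {\<one>} \<rho> (h \<otimes> inv k) v = v'" "mon_left G {\<one>} \<rho> (h \<otimes> inv k) w = w'"
      using mon_left_mon_vertex[OF U \<rho> a] h k \<tau> by simp_all
    then show ?thesis using mon_left_in_mg_Aut[OF U S \<rho> \<tau> \<tau>2 a] by blast
  qed
  then show ?thesis unfolding mg_arc_transitive_def by (intro ballI case_prodI2) simp
qed

end

theorem theorem4p1:
  fixes G :: "('a, 'b) monoid_scheme" and U S :: "'a set" and \<rho> \<tau> :: 'a
  assumes "group G"
    and "\<rho> \<in> carrier G" and "\<tau> \<in> carrier G"
    and "generate G {\<rho>, \<tau>} = carrier G"
    and "\<tau> [^]\<^bsub>G\<^esub> (2::nat) = \<one>\<^bsub>G\<^esub>"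
    and "subgroup U G" and "core_free G U"
    and "right_transversal G U S"
    and "mg_connected (Mon G U S \<rho> \<tau>)"
  shows "subgroup (mon_left_group G U \<rho>) (mg_Aut_group (Mon G U S \<rho> \<tau>)) \<and>
         (U = {\<one>\<^bsub>G\<^esub>} \<longrightarrow> mg_arc_transitive (Mon G U S \<rho> \<tau>))"
proof -
  interpret group G by fact
  show ?thesis
    using subgroup_mon_left_group[OF assms(6,8,2,3,5)]
      mg_arc_transitive_Mon[OF _ assms(2,3,5)] assms(8) by auto
qed

end
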